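(* Let $m>1$ be an integer, $n=2m$, and let $X_1,\dots,X_m,T_1,\dots,T_m$ be mutually independent random variables, each uniformly distributed on $[-1,1]$. Put $X_{m+1}:=X_1$, $S_k = X_k - X_{k+1}$ for $k=1,\dots,m$, and $$Y_{2k-1}=\frac{S_k}{2}+\left(1-\frac{|S_k|}{2}\right)T_k,\qquad Y_{2k}=\frac{S_k}{2}-\left(1-\frac{|S_k|}{2}\right)T_k\qquad (k=1,\dots,m).$$ Let $\sigma$ be a random permutation of $\{1,\dots,n\}$, chosen uniformly and independently of $\vec Y=(Y_1,\dots,Y_n)$. Then $\vec W=\sigma(\vec Y):=(Y_{\sigma(1)},\dots,Y_{\sigma(n)})$ is a random balanced sample of size $n$ whose distribution has all of $M(n)$ as its support.
   Context: A random balanced sample (RBS) of size $n$ is a system of random variables $\vec X=(X_1,\dots,X_n)$ such that $\sum_{k=1}^n X_k=0$ and each $X_k$ is uniformly distributed on $[-1,1]$. $M(n)=\{\vec x\in[-1,1]^n:\sum_{k=1}^n x_k=0\}$. *)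

theory Defs
  imports "HOL-Probability.Probability" "HOL-Combinatorics.Permutations"
begin

(* Vectors of length n are functions on {1..n}, extensional (undefined elsewhere) wherever they
   are points of the product space PiM {1..n} (\<lambda>_. borel). *)

definition uniform_pm1 :: "'a measure \<Rightarrow> ('a \<Rightarrow> real) \<Rightarrow> bool" where
  "uniform_pm1 M X \<longleftrightarrow>
     distributed M lborel X (\<lambda>x. indicator {-1..1} x / measure lborel {-1..1::real})"

(* The equation between the random variables is, as usual, understood almost surely. *)
definition random_balanced_sample :: "'a measure \<Rightarrow> nat \<Rightarrow> (nat \<Rightarrow> 'a \<Rightarrow> real) \<Rightarrow> bool" where
  "random_balanced_sample M n X \<longleftrightarrow>
     prob_space M \<and>
     (\<forall>k\<in>{1..n}. uniform_pm1 M (X k)) \<and>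
     (AE \<omega> in M. (\<Sum>k=1..n. X k \<omega>) = 0)"

definition balanced_set :: "nat \<Rightarrow> (nat \<Rightarrow> real) set" where
  "balanced_set n = {x \<in> {1..n} \<rightarrow>\<^sub>E {-1..1}. (\<Sum>k=1..n. x k) = 0}"

definition random_vector :: "nat \<Rightarrow> (nat \<Rightarrow> 'a \<Rightarrow> real) \<Rightarrow> 'a \<Rightarrow> nat \<Rightarrow> real" where
  "random_vector n X \<omega> = (\<lambda>k\<in>{1..n}. X k \<omega>)"

definition joint_distribution ::
    "'a measure \<Rightarrow> nat \<Rightarrow> (nat \<Rightarrow> 'a \<Rightarrow> real) \<Rightarrow> (nat \<Rightarrow> real) measure" where
  "joint_distribution M n X = distr M (PiM {1..n} (\<lambda>_. borel)) (random_vector n X)"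

(* Intended for measures whose sigma-algebra contains the open sets of T (so that emeasure is
   meaningful on them); this holds for PiM {1..n} (\<lambda>_. borel) and powertop_real {1..n}. *)
definition measure_support :: "'b topology \<Rightarrow> 'b measure \<Rightarrow> 'b set" where
  "measure_support T \<mu> = {x \<in> topspace T. \<forall>U. openin T U \<and> x \<in> U \<longrightarrow> emeasure \<mu> U > 0}"

definition uniform_random_permutation :: "'a measure \<Rightarrow> nat \<Rightarrow> ('a \<Rightarrow> nat \<Rightarrow> nat) \<Rightarrow> bool" where
  "uniform_random_permutation M n \<sigma> \<longleftrightarrow>
     \<sigma> \<in> measurable M (count_space {p. p permutes {1..n}}) \<and>
     distr M (count_space {p. p permutes {1..n}}) \<sigma> = uniform_count_measure {p. p permutes {1..n}}"

(* Independence of the generated sigma-algebras; the library's indep_var requires both variables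
   to take values in the same type. *)
definition indep_perm_vector ::
    "'a measure \<Rightarrow> nat \<Rightarrow> ('a \<Rightarrow> nat \<Rightarrow> nat) \<Rightarrow> (nat \<Rightarrow> 'a \<Rightarrow> real) \<Rightarrow> bool" where
  "indep_perm_vector M n \<sigma> Y \<longleftrightarrow>
     prob_space.indep_set M
       (sets (vimage_algebra (space M) \<sigma> (count_space {p. p permutes {1..n}})))
       (sets (vimage_algebra (space M) (random_vector n Y) (PiM {1..n} (\<lambda>_. borel))))"

end

theory Submission
  imports Defs
begin

text \<open>
  The difference \<open>s\<close> of two uniform variables has density \<open>(2 - \<bar>s\<bar>) / 4\<close>, and given \<open>s\<close> each member of
  the pair is uniform on an interval of length \<open>2 - \<bar>s\<bar>\<close>. The two factors cancel, so the density
  at \<open>y \<in> [-1, 1]\<close> is proportional to the length of the set of \<open>s\<close> whose interval contains \<open>y\<close>,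
  which is \<open>[y - 1, y + 1]\<close>: each \<open>Y\<^sub>l\<close> is uniform, hence so is each \<open>W\<^sub>k\<close>. The sum of the \<open>Y\<^sub>l\<close>
  telescopes to \<open>0\<close>.

  For the support, the coordinates of a balanced vector can be ordered so that all partial sums lie
  in \<open>[-1, 1]\<close>. Pairing consecutive coordinates and taking \<open>X\<^bsub>k+1\<^esub>\<close> to be minus the partial sum of
  the first \<open>2k\<close> of them exhibits the vector as a value of \<open>\<sigma>(Y)\<close> for one permutation \<open>\<sigma>\<close> and one
  point of the parameter cube; neighbourhoods of that point have positive probability.
\<close>

subsection \<open>Uniformity of the pairs\<close>

text \<open>Substitution \<open>y = c + a * t\<close>. Keeping the factor \<open>|a|\<close> on the
  left, instead of dividing by it, admits \<open>a = 0\<close>, where the segment is a point and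
  both sides vanish; this case arises below for \<open>|s| = 2\<close>.\<close>

lemma nn_integral_affine_segment:
  fixes f :: "real \<Rightarrow> ennreal" and a c :: real
  assumes [measurable]: "f \<in> borel_measurable borel"
  shows "ennreal \<bar>a\<bar> * (\<integral>\<^sup>+t\<in>{-1..1}. f (c + a * t) \<partial>lborel) = (\<integral>\<^sup>+y\<in>{c - \<bar>a\<bar>..c + \<bar>a\<bar>}. f y \<partial>lborel)"
proof (cases "a = 0")
  case True
  have "AE y in lborel. f y * indicator {c} y = 0"
    using AE_lborel_singleton[of c] by eventually_elim auto
  then have "(\<integral>\<^sup>+y\<in>{c}. f y \<partial>lborel) = 0"
    by (subst nn_integral_0_iff_AE) auto
  with True show ?thesis
    by simp
next
  case False
  have "(indicator {c - \<bar>a\<bar>..c + \<bar>a\<bar>} (c + a * t) :: ennreal) = indicator {-1..1} t" for t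
  proof -
    have "c + a * t \<in> {c - \<bar>a\<bar>..c + \<bar>a\<bar>} \<longleftrightarrow> \<bar>a\<bar> * \<bar>t\<bar> \<le> \<bar>a\<bar> * 1"
      by (auto simp: abs_mult[symmetric] abs_le_iff)
    also have "\<dots> \<longleftrightarrow> t \<in> {-1..1}"
      using False by (subst mult_le_cancel_left_pos) auto
    finally show ?thesis
      by (auto simp: indicator_def)
  qed
  then show ?thesis
    using False by (subst nn_integral_real_affine[of _ a c]) auto
qed

text \<open>Put \<open>u = v + s\<close> and integrate over \<open>v\<close> first: the
  \<open>v\<close> with both \<open>v\<close> and \<open>v + s\<close> in [-1, 1] form an interval
  of length \<open>2 - |s|\<close>, which is empty or a point once \<open>|s| >= 2\<close>.\<close>

lemma nn_integral_difference_segment: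
  fixes h :: "real \<Rightarrow> ennreal"
  assumes [measurable]: "h \<in> borel_measurable borel"
  shows "(\<integral>\<^sup>+u\<in>{-1..1}. (\<integral>\<^sup>+v\<in>{-1..1}. h (u - v) \<partial>lborel) \<partial>lborel)
       = (\<integral>\<^sup>+s\<in>{-2..2}. ennreal (2 - \<bar>s\<bar>) * h s \<partial>lborel)"
proof -
  have "(\<integral>\<^sup>+u\<in>{-1..1}. (\<integral>\<^sup>+v\<in>{-1..1}. h (u - v) \<partial>lborel) \<partial>lborel)
      = (\<integral>\<^sup>+u. (\<integral>\<^sup>+v. h (u - v) * indicator {-1..1} v * indicator {-1..1} u \<partial>lborel) \<partial>lborel)"
    by (simp add: nn_integral_multc)
  also have "\<dots> = (\<integral>\<^sup>+v. (\<integral>\<^sup>+u. h (u - v) * indicator {-1..1} v * indicator {-1..1} u \<partial>lborel) \<partial>lborel)"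
    by (rule lborel_pair.Fubini'[symmetric]) simp
  also have "\<dots> = (\<integral>\<^sup>+v. (\<integral>\<^sup>+s. h s * indicator {-1..1} v * indicator {-1..1} (v + s) \<partial>lborel) \<partial>lborel)"
  proof (rule nn_integral_cong)
    fix v :: real
    show "(\<integral>\<^sup>+u. h (u - v) * indicator {-1..1} v * indicator {-1..1} u \<partial>lborel)
        = (\<integral>\<^sup>+s. h s * indicator {-1..1} v * indicator {-1..1} (v + s) \<partial>lborel)"
      using nn_integral_real_affine[of "\<lambda>u. h (u - v) * indicator {-1..1} v * indicator {-1..1} u" 1 v]
      by simp
  qed
  also have "\<dots> = (\<integral>\<^sup>+s. (\<integral>\<^sup>+v. h s * indicator {-1..1} v * indicator {-1..1} (v + s) \<partial>lborel) \<partial>lborel)"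
    by (rule lborel_pair.Fubini') simp
  also have "\<dots> = (\<integral>\<^sup>+s. h s * emeasure lborel {max (-1) (-1 - s)..min 1 (1 - s)} \<partial>lborel)"
    by (intro nn_integral_cong)
       (auto simp: mult.assoc nn_integral_cmult simp flip: nn_integral_indicator
             intro!: arg_cong2[where f = "(*)"] nn_integral_cong split: split_indicator)
  also have "\<dots> = (\<integral>\<^sup>+s\<in>{-2..2}. ennreal (2 - \<bar>s\<bar>) * h s \<partial>lborel)"
    by (intro nn_integral_cong)
       (auto simp: emeasure_lborel_Icc_eq max_def min_def ac_simps ennreal_neg split: split_indicator)
  finally show ?thesis .
qed

text \<open>The integrals carry no normalization, so the constant is 2 from
  \<open>2 - |s| = 2 * (1 - |s| / 2)\<close> times 2, the length of \<open>[y - 1, y + 1]\<close>.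
  The sign \<open>e\<close> covers both members of a pair.\<close>

lemma nn_integral_balanced_pair:
  fixes f :: "real \<Rightarrow> ennreal" and e :: real
  assumes [measurable]: "f \<in> borel_measurable borel" and e: "\<bar>e\<bar> = 1"
  shows "(\<integral>\<^sup>+u\<in>{-1..1}. (\<integral>\<^sup>+v\<in>{-1..1}. (\<integral>\<^sup>+t\<in>{-1..1}.
            f ((u - v) / 2 + (1 - \<bar>u - v\<bar> / 2) * (e * t)) \<partial>lborel) \<partial>lborel) \<partial>lborel)
       = 4 * (\<integral>\<^sup>+y\<in>{-1..1}. f y \<partial>lborel)"
proof -
  define h where "h s = (\<integral>\<^sup>+t\<in>{-1..1}. f (s / 2 + (1 - \<bar>s\<bar> / 2) * (e * t)) \<partial>lborel)" for s
  have [measurable]: "h \<in> borel_measurable borel"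
    unfolding h_def by simp
  have h: "ennreal (2 - \<bar>s\<bar>) * h s = 2 * (\<integral>\<^sup>+y. f y * indicator {max (-1) (s - 1)..min 1 (s + 1)} y \<partial>lborel)"
    if "s \<in> {-2..2}" for s
  proof -
    have "ennreal (2 - \<bar>s\<bar>) = 2 * ennreal (\<bar>(1 - \<bar>s\<bar> / 2) * e\<bar>)"
      using that e by (auto simp: abs_mult simp flip: ennreal_numeral ennreal_mult)
    moreover have "\<bar>(1 - \<bar>s\<bar> / 2) * e\<bar> = 1 - \<bar>s\<bar> / 2"
      using that e by (auto simp: abs_mult)
    \<comment> \<open>The segment with centre \<open>s / 2\<close> and half-length
      \<open>1 - |s| / 2\<close> is the intersection of [-1, 1] and
      \<open>[s - 1, s + 1]\<close>.\<close>
    moreover have "s / 2 - (1 - \<bar>s\<bar> / 2) = max (-1) (s - 1)" "s / 2 + (1 - \<bar>s\<bar> / 2) = min 1 (s + 1)"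
      by (auto simp: max_def min_def abs_if field_simps)
    ultimately show ?thesis
      using nn_integral_affine_segment[of f "(1 - \<bar>s\<bar> / 2) * e" "s / 2"]
      by (simp add: h_def mult.assoc)
  qed
  have "(\<integral>\<^sup>+u\<in>{-1..1}. (\<integral>\<^sup>+v\<in>{-1..1}. h (u - v) \<partial>lborel) \<partial>lborel)
      = (\<integral>\<^sup>+s\<in>{-2..2}. ennreal (2 - \<bar>s\<bar>) * h s \<partial>lborel)"
    by (rule nn_integral_difference_segment) simp
  \<comment> \<open>Membership of \<open>y\<close> in \<open>[s - 1, s + 1]\<close> is membership of
    \<open>s\<close> in \<open>[y - 1, y + 1]\<close>, which prepares the exchange of integrals. For
    \<open>y\<close> in [-1, 1] this interval lies in [-2, 2], so the restriction on
    \<open>s\<close> disappears.\<close>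
  also have "\<dots> = (\<integral>\<^sup>+s. 2 * (\<integral>\<^sup>+y. f y * indicator {-1..1} y * indicator {y - 1..y + 1} s \<partial>lborel) \<partial>lborel)"
  proof (intro nn_integral_cong)
    fix s :: real
    show "ennreal (2 - \<bar>s\<bar>) * h s * indicator {-2..2} s
        = 2 * (\<integral>\<^sup>+y. f y * indicator {-1..1} y * indicator {y - 1..y + 1} s \<partial>lborel)"
    proof (cases "s \<in> {-2..2}")
      case True
      then show ?thesis
        using h[OF True]
        by (auto intro!: arg_cong[where f = "(*) 2"] nn_integral_cong split: split_indicator)
    next
      case False
      then have "(\<lambda>y. f y * indicator {-1..1} y * indicator {y - 1..y + 1} s) = (\<lambda>_. 0)"
        by (auto simp: fun_eq_iff split: split_indicator)
      with False show ?thesis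
        by simp
    qed
  qed
  also have "\<dots> = 2 * (\<integral>\<^sup>+s. (\<integral>\<^sup>+y. f y * indicator {-1..1} y * indicator {y - 1..y + 1} s \<partial>lborel) \<partial>lborel)"
    by (simp add: nn_integral_cmult indicator_def)
  also have "\<dots> = 2 * (\<integral>\<^sup>+y. (\<integral>\<^sup>+s. f y * indicator {-1..1} y * indicator {y - 1..y + 1} s \<partial>lborel) \<partial>lborel)"
    by (subst lborel_pair.Fubini') (simp_all add: indicator_def)
  also have "\<dots> = 2 * (\<integral>\<^sup>+y. 2 * (f y * indicator {-1..1} y) \<partial>lborel)"
    by (simp add: nn_integral_cmult mult.commute)
  also have "\<dots> = 4 * (\<integral>\<^sup>+y\<in>{-1..1}. f y \<partial>lborel)"
    by (subst nn_integral_cmult) (simp_all flip: mult.assoc)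
  finally show ?thesis
    by (simp add: h_def)
qed

section \<open>The uniform distribution on [-1, 1]\<close>

definition pm1_distr :: "real measure" where
  "pm1_distr = density lborel (\<lambda>x. ennreal (indicator {-1..1} x / 2))"

lemma sets_pm1_distr [simp, measurable_cong]: "sets pm1_distr = sets borel"
  by (simp add: pm1_distr_def)

lemma space_pm1_distr [simp]: "space pm1_distr = UNIV"
  by (simp add: pm1_distr_def)

lemma nn_integral_pm1_distr:
  assumes [measurable]: "f \<in> borel_measurable borel"
  shows "(\<integral>\<^sup>+x. f x \<partial>pm1_distr) = ennreal (1 / 2) * (\<integral>\<^sup>+x\<in>{-1..1}. f x \<partial>lborel)"
proof -
  have "(\<integral>\<^sup>+x. f x \<partial>pm1_distr) = (\<integral>\<^sup>+x. ennreal (1 / 2) * (f x * indicator {-1..1} x) \<partial>lborel)"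
    unfolding pm1_distr_def
    by (subst nn_integral_density) (auto intro!: nn_integral_cong split: split_indicator simp: mult.commute)
  then show ?thesis
    by (simp add: nn_integral_cmult)
qed

lemma emeasure_pm1_distr:
  assumes "A \<in> sets borel"
  shows "emeasure pm1_distr A = ennreal (1 / 2) * emeasure lborel (A \<inter> {-1..1})"
proof -
  have ind: "indicator (A \<inter> {-1..1}) = (\<lambda>x. indicator A x * indicator {-1..1} x :: ennreal)"
    by (simp add: fun_eq_iff indicator_inter_arith)
  have "emeasure pm1_distr A = (\<integral>\<^sup>+x. indicator A x \<partial>pm1_distr)"
    using assms by simp
  also have "\<dots> = ennreal (1 / 2) * (\<integral>\<^sup>+x. indicator (A \<inter> {-1..1}) x \<partial>lborel)"
    using assms by (simp only: ind nn_integral_pm1_distr borel_measurable_indicator)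
  also have "(\<integral>\<^sup>+x. indicator (A \<inter> {-1..1}) x \<partial>lborel) = emeasure lborel (A \<inter> {-1..1})"
    using assms by (intro nn_integral_indicator) auto
  finally show ?thesis .
qed

lemma prob_space_pm1_distr: "prob_space pm1_distr"
proof (rule prob_spaceI)
  have "emeasure pm1_distr (space pm1_distr) = ennreal (1 / 2) * ennreal 2"
    by (simp add: emeasure_pm1_distr)
  also have "\<dots> = 1"
    by (subst ennreal_mult[symmetric]) auto
  finally show "emeasure pm1_distr (space pm1_distr) = 1" .
qed

text \<open>Since \<open>lborel\<close> and \<open>borel\<close> have the same measurable sets,
  \<open>distributed\<close> becomes an equality of laws on \<open>borel\<close>. In this form the
  laws can be inserted into product measures.\<close>

lemma uniform_pm1_iff_distr:
  "uniform_pm1 M X \<longleftrightarrow> X \<in> borel_measurable M \<and> distr M borel X = pm1_distr"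
proof -
  have "distr M lborel X = distr M borel X"
    by (rule distr_cong) auto
  then show ?thesis
    by (auto simp: uniform_pm1_def distributed_def pm1_distr_def)
qed

lemma uniform_pm1_iff_emeasure:
  "uniform_pm1 M X \<longleftrightarrow> X \<in> borel_measurable M \<and>
     (\<forall>A\<in>sets borel. emeasure M (X -` A \<inter> space M) = emeasure pm1_distr A)"
  unfolding uniform_pm1_iff_distr
  by (auto intro!: measure_eqI simp: emeasure_distr)
     (metis emeasure_distr)

lemma uniform_pm1_cong:
  assumes "\<And>\<omega>. \<omega> \<in> space M \<Longrightarrow> X \<omega> = X' \<omega>"
  shows "uniform_pm1 M X \<longleftrightarrow> uniform_pm1 M X'"
  using assms measurable_cong[of M X X' borel] distr_cong[of M M borel borel X X']
  by (auto simp: uniform_pm1_iff_distr)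

lemma AE_uniform_pm1:
  assumes "uniform_pm1 M X"
  shows "AE \<omega> in M. X \<omega> \<in> {-1..1}"
proof (rule AE_I)
  show "emeasure M (X -` (- {-1..1}) \<inter> space M) = 0"
    using assms by (auto simp: uniform_pm1_iff_emeasure emeasure_pm1_distr)
  show "X -` (- {-1..1}) \<inter> space M \<in> sets M"
    using assms by (auto simp: uniform_pm1_iff_emeasure intro!: measurable_sets)
qed auto

text \<open>By independence the joint law of the three variables is a product of copies of
  \<open>pm1_distr\<close>, so the probability of a set \<open>A\<close> is the triple integral of
  \<open>nn_integral_balanced_pair\<close> with the indicator of \<open>A\<close> as
  \<open>f\<close>.\<close>

lemma uniform_pm1_balanced_pair:
  fixes Z :: "'i \<Rightarrow> 'a \<Rightarrow> real" and e :: real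
  assumes "prob_space M"
    and indep: "prob_space.indep_vars M (\<lambda>_. borel) Z {i, j, k}"
    and dist: "i \<noteq> j" "i \<noteq> k" "j \<noteq> k"
    and unif: "\<And>l. l \<in> {i, j, k} \<Longrightarrow> uniform_pm1 M (Z l)"
    and e: "\<bar>e\<bar> = 1"
  shows "uniform_pm1 M (\<lambda>\<omega>. (Z i \<omega> - Z j \<omega>) / 2 + (1 - \<bar>Z i \<omega> - Z j \<omega>\<bar> / 2) * (e * Z k \<omega>))"
proof -
  interpret prob_space M by fact
  interpret P: product_prob_space "\<lambda>_. pm1_distr" "{i, j, k}"
    by (intro product_prob_spaceI prob_space_pm1_distr)
  define g where "g z = (z i - z j) / 2 + (1 - \<bar>z i - z j\<bar> / 2) * (e * z k)" for z :: "'i \<Rightarrow> real"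
  have [measurable]: "Z i \<in> borel_measurable M" "Z j \<in> borel_measurable M" "Z k \<in> borel_measurable M"
    using unif by (auto simp: uniform_pm1_iff_distr)
  define V where "V \<omega> = (\<lambda>l\<in>{i, j, k}. Z l \<omega>)" for \<omega>
  have [measurable]: "V \<in> M \<rightarrow>\<^sub>M PiM {i, j, k} (\<lambda>_. borel)"
    unfolding V_def by (rule measurable_restrict) auto
  have [measurable]: "g \<in> PiM {i, j, k} (\<lambda>_. borel) \<rightarrow>\<^sub>M borel"
    unfolding g_def by measurable
  have [measurable]: "g \<in> PiM {i, j, k} (\<lambda>_. pm1_distr) \<rightarrow>\<^sub>M borel"
    unfolding g_def by measurable
  have distr_V: "distr M (PiM {i, j, k} (\<lambda>_. borel)) V = PiM {i, j, k} (\<lambda>_. pm1_distr)"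
  proof -
    have "distr M (PiM {i, j, k} (\<lambda>_. borel)) V = PiM {i, j, k} (\<lambda>l. distr M borel (Z l))"
      unfolding V_def by (rule indep_vars_iff_distr_eq_PiM'[THEN iffD1, OF _ _ indep])
        (use unif in \<open>auto simp: uniform_pm1_iff_distr\<close>)
    also have "\<dots> = PiM {i, j, k} (\<lambda>_. pm1_distr)"
      by (rule PiM_cong) (use unif in \<open>auto simp: uniform_pm1_iff_distr\<close>)
    finally show ?thesis .
  qed
  have "emeasure M ((\<lambda>\<omega>. g (V \<omega>)) -` A \<inter> space M) = emeasure pm1_distr A"
    if [measurable]: "A \<in> sets borel" for A
  proof -
    define f :: "real \<Rightarrow> ennreal" where "f = indicator A"
    have [measurable]: "f \<in> borel_measurable borel"
      unfolding f_def by measurable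
    have "emeasure M ((\<lambda>\<omega>. g (V \<omega>)) -` A \<inter> space M) = (\<integral>\<^sup>+\<omega>. indicator ((\<lambda>\<omega>. g (V \<omega>)) -` A \<inter> space M) \<omega> \<partial>M)"
      by (rule nn_integral_indicator[symmetric]) measurable
    also have "\<dots> = (\<integral>\<^sup>+\<omega>. f (g (V \<omega>)) \<partial>M)"
      by (rule nn_integral_cong) (simp add: f_def indicator_def)
    also have "\<dots> = (\<integral>\<^sup>+z. f (g z) \<partial>PiM {i, j, k} (\<lambda>_. pm1_distr))"
      by (subst distr_V[symmetric], subst nn_integral_distr) auto
    also have "\<dots> = (\<integral>\<^sup>+u. \<integral>\<^sup>+v. \<integral>\<^sup>+t. f ((u - v) / 2 + (1 - \<bar>u - v\<bar> / 2) * (e * t))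
        \<partial>pm1_distr \<partial>pm1_distr \<partial>pm1_distr)"
    proof -
      \<comment> \<open>The coordinates are split off one at a time, \<open>i\<close> outermost and
        \<open>k\<close> innermost.\<close>
      have "(\<integral>\<^sup>+z. f (g z) \<partial>PiM {i, j, k} (\<lambda>_. pm1_distr))
          = (\<integral>\<^sup>+u. \<integral>\<^sup>+z. f (g (z(i := u))) \<partial>PiM {j, k} (\<lambda>_. pm1_distr) \<partial>pm1_distr)"
        using dist by (intro P.product_nn_integral_insert_rev) auto
      also have "\<dots> = (\<integral>\<^sup>+u. \<integral>\<^sup>+v. \<integral>\<^sup>+z. f (g (z(j := v, i := u))) \<partial>PiM {k} (\<lambda>_. pm1_distr) \<partial>pm1_distr \<partial>pm1_distr)"
        using dist unfolding g_def
        by (intro nn_integral_cong P.product_nn_integral_insert_rev) (auto, measurable)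
      also have "\<dots> = (\<integral>\<^sup>+u. \<integral>\<^sup>+v. \<integral>\<^sup>+z. f ((u - v) / 2 + (1 - \<bar>u - v\<bar> / 2) * (e * z k)) \<partial>PiM {k} (\<lambda>_. pm1_distr) \<partial>pm1_distr \<partial>pm1_distr)"
        using dist by (simp add: g_def)
      also have "\<dots> = (\<integral>\<^sup>+u. \<integral>\<^sup>+v. \<integral>\<^sup>+t. f ((u - v) / 2 + (1 - \<bar>u - v\<bar> / 2) * (e * t))
          \<partial>pm1_distr \<partial>pm1_distr \<partial>pm1_distr)"
        by (intro nn_integral_cong P.product_nn_integral_singleton) measurable
      finally show ?thesis .
    qed
    also have "\<dots> = ennreal (1 / 2) * (ennreal (1 / 2) * (ennreal (1 / 2) *
        (\<integral>\<^sup>+u\<in>{-1..1}. (\<integral>\<^sup>+v\<in>{-1..1}. (\<integral>\<^sup>+t\<in>{-1..1}.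
            f ((u - v) / 2 + (1 - \<bar>u - v\<bar> / 2) * (e * t)) \<partial>lborel) \<partial>lborel) \<partial>lborel)))"
      by (simp add: nn_integral_pm1_distr nn_integral_cmult mult.assoc)
    also have "\<dots> = ennreal (1 / 2) * (ennreal (1 / 2) * (ennreal (1 / 2) * 4)) * (\<integral>\<^sup>+y\<in>{-1..1}. f y \<partial>lborel)"
      using e by (simp add: nn_integral_balanced_pair mult.assoc)
    \<comment> \<open>Three densities 1/2 against the constant 4 leave 1/2, the density of a single
      uniform variable.\<close>
    also have "ennreal (1 / 2) * (ennreal (1 / 2) * (ennreal (1 / 2) * 4)) = ennreal (1 / 2)"
      by (simp add: ennreal_mult[symmetric] del: ennreal_half flip: ennreal_numeral)
    also have "ennreal (1 / 2) * (\<integral>\<^sup>+y\<in>{-1..1}. f y \<partial>lborel) = (\<integral>\<^sup>+y. f y \<partial>pm1_distr)"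
      by (simp add: nn_integral_pm1_distr)
    also have "\<dots> = emeasure pm1_distr A"
      by (simp add: f_def)
    finally show ?thesis .
  qed
  then have "uniform_pm1 M (\<lambda>\<omega>. g (V \<omega>))"
    unfolding uniform_pm1_iff_emeasure by auto
  then show ?thesis
    by (simp add: g_def V_def)
qed

section \<open>Shuffling by an independent uniform permutation\<close>

lemma random_vector_measurable:
  assumes "\<And>k. k \<in> {1..n} \<Longrightarrow> Y k \<in> borel_measurable M"
  shows "random_vector n Y \<in> M \<rightarrow>\<^sub>M PiM {1..n} (\<lambda>_. borel)"
  unfolding random_vector_def using assms by (intro measurable_restrict) auto

lemma uniform_random_permutation_permutes:
  assumes "uniform_random_permutation M n \<sigma>" "\<omega> \<in> space M"
  shows "\<sigma> \<omega> permutes {1..n}"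
  using assms by (auto simp: uniform_random_permutation_def dest: measurable_space)

text \<open>Each permutation has probability \<open>1 / fact n\<close>, and independence makes the
  probabilities multiply. Sets \<open>B\<close> of whole vectors serve both the marginals of the
  shuffled vector and the boxes used for the support.\<close>

lemma measure_permutation_vector:
  assumes "prob_space M" "uniform_random_permutation M n \<sigma>" "indep_perm_vector M n \<sigma> Y"
    and p: "p permutes {1..n}" and B: "B \<in> sets (PiM {1..n} (\<lambda>_. borel))"
  shows "measure M ({\<omega> \<in> space M. \<sigma> \<omega> = p} \<inter> (random_vector n Y -` B \<inter> space M))
       = measure M (random_vector n Y -` B \<inter> space M) / fact n"
proof -
  interpret prob_space M by fact
  let ?P = "{p. p permutes {1..n}}"
  have card: "card ?P = fact n"
    by (simp add: card_permutations)
  have \<sigma>: "\<sigma> \<in> measurable M (count_space ?P)"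
    "distr M (count_space ?P) \<sigma> = uniform_count_measure ?P"
    using assms(2) by (auto simp: uniform_random_permutation_def)
  have eq: "{\<omega> \<in> space M. \<sigma> \<omega> = p} = \<sigma> -` {p} \<inter> space M"
    by auto
  have "prob {\<omega> \<in> space M. \<sigma> \<omega> = p} = measure (distr M (count_space ?P) \<sigma>) {p}"
    using \<sigma>(1) p by (subst measure_distr) (auto simp: eq)
  also have "\<dots> = 1 / fact n"
    unfolding \<sigma>(2) using p card
    by (subst measure_uniform_count_measure) (auto simp: finite_permutations)
  finally have prob: "prob {\<omega> \<in> space M. \<sigma> \<omega> = p} = 1 / fact n" .
  have "prob ({\<omega> \<in> space M. \<sigma> \<omega> = p} \<inter> (random_vector n Y -` B \<inter> space M))
      = prob {\<omega> \<in> space M. \<sigma> \<omega> = p} * prob (random_vector n Y -` B \<inter> space M)"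
    using assms(3) unfolding indep_perm_vector_def
  proof (rule indep_setD)
    show "{\<omega> \<in> space M. \<sigma> \<omega> = p} \<in> sets (vimage_algebra (space M) \<sigma> (count_space ?P))"
      unfolding eq using p by (intro in_vimage_algebra) auto
  qed (use B in \<open>rule in_vimage_algebra\<close>)
  then show ?thesis
    by (simp add: prob)
qed

text \<open>Where \<open>\<sigma>\<close> equals \<open>p\<close>, the variable is
  \<open>Y (p k)\<close>, which is uniform for every \<open>p\<close>. Each of the
  \<open>fact n\<close> permutations contributes the same share \<open>1 / fact n\<close> of the
  uniform law.\<close>

lemma uniform_pm1_permuted:
  assumes "prob_space M" and \<sigma>: "uniform_random_permutation M n \<sigma>" and indep: "indep_perm_vector M n \<sigma> Y"
    and Y: "\<And>l. l \<in> {1..n} \<Longrightarrow> uniform_pm1 M (Y l)" and k: "k \<in> {1..n}"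
  shows "uniform_pm1 M (\<lambda>\<omega>. Y (\<sigma> \<omega> k) \<omega>)"
proof -
  interpret prob_space M by fact
  let ?P = "{p. p permutes {1..n}}" and ?W = "\<lambda>\<omega>. Y (\<sigma> \<omega> k) \<omega>"
  have P: "finite ?P" "card ?P = fact n"
    by (simp_all add: card_permutations finite_permutations)
  have Ym: "Y l \<in> borel_measurable M" if "l \<in> {1..n}" for l
    using Y[OF that] by (simp add: uniform_pm1_iff_distr)
  define E where "E A p = {\<omega> \<in> space M. \<sigma> \<omega> = p} \<inter> (Y (p k) -` A \<inter> space M)" for A p
  have pk: "p k \<in> {1..n}" if "p \<in> ?P" for p
    using that k permutes_in_image[of p "{1..n}" k] by simp
  have E_sets: "E A p \<in> sets M" if "p \<in> ?P" "A \<in> sets borel" for A p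
  proof -
    have "\<sigma> -` {p} \<inter> space M \<in> sets M"
      using \<sigma> that(1) by (intro measurable_sets) (auto simp: uniform_random_permutation_def)
    also have "\<sigma> -` {p} \<inter> space M = {\<omega> \<in> space M. \<sigma> \<omega> = p}"
      by auto
    finally show ?thesis
      using measurable_sets[OF Ym[OF pk[OF that(1)]] that(2)] by (auto simp: E_def)
  qed
  have W_eq: "?W -` A \<inter> space M = (\<Union>p\<in>?P. E A p)" for A
    using uniform_random_permutation_permutes[OF \<sigma>] by (auto simp: E_def)
  \<comment> \<open>The index itself depends on the outcome, so measurability also comes from the
    finite splitting by the value of \<open>\<sigma>\<close>.\<close>
  have meas: "?W \<in> borel_measurable M"
  proof (rule measurableI)
    show "?W -` A \<inter> space M \<in> sets M" if "A \<in> sets borel" for A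
      unfolding W_eq using E_sets that P by (intro sets.finite_UN) auto
  qed auto
  have E_prob: "prob (E A p) = measure pm1_distr A / fact n" if p: "p \<in> ?P" and A: "A \<in> sets borel" for A p
  proof -
    \<comment> \<open>The condition on the single coordinate \<open>p k\<close> is rewritten as a
      set of vectors, the form in which independence from \<open>\<sigma>\<close> is
      available.\<close>
    define B where "B = (\<lambda>y. y (p k)) -` A \<inter> space (PiM {1..n} (\<lambda>_. borel :: real measure))"
    have B: "B \<in> sets (PiM {1..n} (\<lambda>_. borel))"
      unfolding B_def using pk[OF p] A by (intro measurable_sets) auto
    have B_eq: "random_vector n Y -` B \<inter> space M = Y (p k) -` A \<inter> space M"
      using pk[OF p] by (auto simp: B_def random_vector_def space_PiM)
    have "prob (E A p) = prob (Y (p k) -` A \<inter> space M) / fact n"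
      using measure_permutation_vector[OF \<open>prob_space M\<close> \<sigma> indep _ B, of p] p
      by (simp add: E_def B_eq)
    also have "prob (Y (p k) -` A \<inter> space M) = measure pm1_distr A"
      using Y[OF pk[OF p]] A by (simp add: uniform_pm1_iff_emeasure measure_def)
    finally show ?thesis .
  qed
  have "emeasure M (?W -` A \<inter> space M) = emeasure pm1_distr A" if A: "A \<in> sets borel" for A
  proof -
    have "prob (?W -` A \<inter> space M) = (\<Sum>p\<in>?P. prob (E A p))"
      unfolding W_eq using P E_sets A
      by (intro finite_measure_finite_Union) (auto simp: disjoint_family_on_def E_def)
    also have "\<dots> = measure pm1_distr A"
      using E_prob A P by simp
    finally show ?thesis
      using prob_space.finite_measure[OF prob_space_pm1_distr]
      by (simp add: emeasure_eq_measure finite_measure.emeasure_eq_measure)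
  qed
  with meas show ?thesis
    by (auto simp: uniform_pm1_iff_emeasure)
qed

text \<open>Even around an endpoint of [-1, 1] a neighbourhood meets the interval in positive
  length, so each factor is positive; independence turns the intersection into a finite
  product.\<close>

lemma indep_uniform_pm1_near:
  fixes Z :: "'i \<Rightarrow> 'a \<Rightarrow> real"
  assumes "prob_space M" "prob_space.indep_vars M (\<lambda>_. borel) Z I" "finite I" "I \<noteq> {}"
    and unif: "\<And>i. i \<in> I \<Longrightarrow> uniform_pm1 M (Z i)"
    and z: "\<And>i. i \<in> I \<Longrightarrow> \<bar>z i\<bar> \<le> 1" and "\<delta> > 0"
  shows "measure M (\<Inter>i\<in>I. Z i -` {z i - \<delta><..<z i + \<delta>} \<inter> space M) > 0"
proof -
  interpret prob_space M by fact
  have "prob (Z i -` {z i - \<delta><..<z i + \<delta>} \<inter> space M) > 0" if "i \<in> I" for i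
  proof -
    have "max (-1) (z i - \<delta>) < min 1 (z i + \<delta>)"
      using z[OF that] \<open>\<delta> > 0\<close> by (auto simp: max_def min_def)
    then have "0 < ennreal (1 / 2) * emeasure lborel {max (-1) (z i - \<delta>)<..<min 1 (z i + \<delta>)}"
      by (auto simp: ennreal_zero_less_mult_iff zero_less_iff_neq_zero)
    also have "\<dots> \<le> ennreal (1 / 2) * emeasure lborel ({z i - \<delta><..<z i + \<delta>} \<inter> {-1..1})"
      by (intro mult_left_mono emeasure_mono) auto
    also have "\<dots> = emeasure M (Z i -` {z i - \<delta><..<z i + \<delta>} \<inter> space M)"
      using unif[OF that] by (simp add: uniform_pm1_iff_emeasure emeasure_pm1_distr)
    finally show ?thesis
      by (simp add: emeasure_eq_measure)
  qed
  then show ?thesis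
    using assms(2-4) by (subst indep_varsD_finite) (auto intro!: prod_pos)
qed

subsection \<open>Parametrizing balanced vectors\<close>

text \<open>A positive partial sum is always continued by a nonpositive value and vice versa.\<close>

lemma balanced_ordering_list:
  fixes f :: "'b \<Rightarrow> real"
  assumes "finite A" "\<And>a. a \<in> A \<Longrightarrow> \<bar>f a\<bar> \<le> 1" "c + sum f A = 0" "\<bar>c\<bar> \<le> 1"
  shows "\<exists>xs. distinct xs \<and> set xs = A \<and> (\<forall>j\<le>length xs. \<bar>c + sum_list (map f (take j xs))\<bar> \<le> 1)"
  using assms
\<comment> \<open>The offset \<open>c\<close> is the partial sum reached so far. Moving the chosen
  \<open>a\<close> out of \<open>A\<close> replaces \<open>c\<close> by \<open>c + f a\<close> and
  preserves the zero total.\<close>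
proof (induction "card A" arbitrary: A c)
  case 0
  then show ?case
    by auto
next
  case (Suc k)
  have ne: "A \<noteq> {}"
    using Suc.hyps(2) by auto
  have "\<exists>a\<in>A. \<bar>c + f a\<bar> \<le> 1"
  proof (cases "c > 0")
    case True
    then have "sum f A < 0"
      using Suc.prems by linarith
    then obtain a where "a \<in> A" "f a < 0"
      by (meson not_le sum_nonneg)
    then show ?thesis
      using Suc.prems(2)[of a] Suc.prems(4) True by (intro bexI[of _ a]) auto
  next
    case False
    then have "\<not> sum f A < 0"
      using Suc.prems by linarith
    then obtain a where "a \<in> A" "f a \<ge> 0"
      using sum_strict_mono[of A f "\<lambda>_. 0"] Suc.prems(1) ne by force
    then show ?thesis
      using Suc.prems(2)[of a] Suc.prems(4) False by (intro bexI[of _ a]) auto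
  qed
  then obtain a where a: "a \<in> A" "\<bar>c + f a\<bar> \<le> 1"
    by blast
  have "\<exists>xs. distinct xs \<and> set xs = A - {a} \<and>
          (\<forall>j\<le>length xs. \<bar>c + f a + sum_list (map f (take j xs))\<bar> \<le> 1)"
    using Suc.prems a Suc.hyps(2) by (intro Suc.hyps(1)) (auto simp: sum_diff1)
  then obtain xs where xs: "distinct xs" "set xs = A - {a}"
      "\<And>j. j \<le> length xs \<Longrightarrow> \<bar>c + f a + sum_list (map f (take j xs))\<bar> \<le> 1"
    by blast
  have "\<bar>c + sum_list (map f (take j (a # xs)))\<bar> \<le> 1" if "j \<le> length (a # xs)" for j
    using that xs(3)[of "j - 1"] Suc.prems(4) by (cases j) (auto simp: add.assoc)
  then show ?case
    using xs a by (intro exI[of _ "a # xs"]) auto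
qed

lemma balanced_ordering:
  fixes x :: "nat \<Rightarrow> real"
  assumes "\<And>k. k \<in> {1..n} \<Longrightarrow> \<bar>x k\<bar> \<le> 1" "(\<Sum>k=1..n. x k) = 0"
  obtains p where "p permutes {1..n}" "\<And>j. j \<le> n \<Longrightarrow> \<bar>\<Sum>i=1..j. x (p i)\<bar> \<le> 1"
proof -
  obtain xs where xs: "distinct xs" "set xs = {1..n}"
      "\<And>j. j \<le> length xs \<Longrightarrow> \<bar>sum_list (map x (take j xs))\<bar> \<le> 1"
    using balanced_ordering_list[of "{1..n}" x 0] assms by auto
  have len: "length xs = n"
    using distinct_card[OF xs(1)] xs(2) by simp
  \<comment> \<open>List positions start at 0 and coordinates at 1, hence the shift. Outside
    \<open>{1..n}\<close> a permutation of this set has to be the identity.\<close>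
  define p where "p i = (if i \<in> {1..n} then xs ! (i - 1) else i)" for i
  have "bij_betw (\<lambda>i. xs ! (i - 1)) {1..n} {1..n}"
  proof (rule bij_betw_trans[where g = "(!) xs", unfolded o_def])
    show "bij_betw (\<lambda>i. i - 1) {1..n} {..<n}"
      by (rule bij_betwI[where g = Suc]) auto
    show "bij_betw ((!) xs) {..<n} {1..n}"
      using bij_betw_nth[OF xs(1)] len xs(2) by simp
  qed
  then have "bij_betw p {1..n} {1..n}"
    by (rule bij_betw_cong[THEN iffD1, rotated]) (simp add: p_def)
  then have "p permutes {1..n}"
    by (rule bij_imp_permutes) (auto simp: p_def)
  moreover have "\<bar>\<Sum>i=1..j. x (p i)\<bar> \<le> 1" if "j \<le> n" for j
  proof -
    have "(\<Sum>i=1..j. x (p i)) = (\<Sum>i<j. x (xs ! i))"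
      using that by (intro sum.reindex_bij_witness[of _ Suc "\<lambda>i. i - 1"]) (auto simp: p_def)
    also have "\<dots> = sum_list (map x (take j xs))"
      using that len by (simp add: sum_list_sum_nth atLeast0LessThan)
    finally show ?thesis
      using xs(3)[of j] that len by simp
  qed
  ultimately show ?thesis
    by (rule that)
qed

lemma sum_consecutive_pairs:
  fixes f :: "nat \<Rightarrow> 'b::comm_monoid_add"
  shows "(\<Sum>l=1..2 * m. f l) = (\<Sum>k=1..m. f (2 * k - 1) + f (2 * k))"
  by (induction m) (auto simp: add.assoc)

lemma sum_telescope_from_1:
  fixes f :: "nat \<Rightarrow> 'b::ab_group_add"
  shows "(\<Sum>k=1..m. f k - f (k + 1)) = f 1 - f (m + 1)"
  by (induction m) auto

lemma odd_even_pair_cases: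
  fixes l m :: nat
  assumes "l \<in> {1..2 * m}"
  obtains k where "k \<in> {1..m}" "l = 2 * k - 1 \<or> l = 2 * k"
proof
  show "(l + 1) div 2 \<in> {1..m}" "l = 2 * ((l + 1) div 2) - 1 \<or> l = 2 * ((l + 1) div 2)"
    using assms by auto
qed

text \<open>If \<open>\<bar>a + b\<bar> = 2\<close>, then \<open>a = b\<close> and the coefficient of \<open>t\<close> vanishes.\<close>

lemma balanced_pair_surj:
  fixes a b :: real
  assumes "\<bar>a\<bar> \<le> 1" "\<bar>b\<bar> \<le> 1"
  obtains t where "\<bar>t\<bar> \<le> 1" "(a + b) / 2 + (1 - \<bar>a + b\<bar> / 2) * t = a"
    "(a + b) / 2 - (1 - \<bar>a + b\<bar> / 2) * t = b"
proof (cases "\<bar>a + b\<bar> = 2")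
  case True
  with assms have "a = b" "\<bar>a + b\<bar> / 2 = 1"
    by auto
  with that[of 0] show ?thesis
    by auto
next
  case False
  with assms have pos: "2 - \<bar>a + b\<bar> > 0"
    by linarith
  define t where "t = (a - b) / (2 - \<bar>a + b\<bar>)"
  have "\<bar>t\<bar> = \<bar>a - b\<bar> / (2 - \<bar>a + b\<bar>)"
    using pos by (simp add: t_def)
  also have "\<dots> \<le> 1"
    using assms pos by (subst divide_le_eq_1_pos) linarith+
  finally have "\<bar>t\<bar> \<le> 1" .
  moreover have "(1 - \<bar>a + b\<bar> / 2) * t = (2 - \<bar>a + b\<bar>) * t / 2"
    by (simp add: field_simps)
  then have "(1 - \<bar>a + b\<bar> / 2) * t = (a - b) / 2"
    using pos by (simp add: t_def)
  ultimately show ?thesis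
    using that[of t] by (simp add: field_simps)
qed

text \<open>The difference splits into \<open>(s - s') / 2\<close>, the change \<open>d\<close> of
  the coefficient at fixed \<open>t'\<close>, and the change \<open>r\<close> of \<open>t\<close> at
  the coefficient of \<open>s\<close>; they contribute at most \<open>\<delta>\<close>,
  \<open>\<delta>\<close> and \<open>2 * \<delta>\<close>, the first strictly less. Bounds are
  assumed at the reference point \<open>(s', t')\<close> only, because the random variables are
  bounded only almost surely; \<open>\<delta> \<le> 1\<close> then keeps the coefficient of
  \<open>s\<close> bounded.\<close>

lemma balanced_pair_close:
  fixes s s' t t' \<delta> :: real
  assumes "\<bar>s - s'\<bar> < 2 * \<delta>" "\<bar>t - t'\<bar> < \<delta>" "\<bar>s'\<bar> \<le> 2" "\<bar>t'\<bar> \<le> 1" "\<delta> \<le> 1"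
  shows "\<bar>(s / 2 + (1 - \<bar>s\<bar> / 2) * t) - (s' / 2 + (1 - \<bar>s'\<bar> / 2) * t')\<bar> < 4 * \<delta>"
proof -
  define d where "d = (\<bar>s'\<bar> / 2 - \<bar>s\<bar> / 2) * t'"
  define r where "r = (1 - \<bar>s\<bar> / 2) * (t - t')"
  have "\<bar>d\<bar> \<le> \<delta> * 1"
    unfolding d_def abs_mult using assms by (intro mult_mono) linarith+
  moreover have "\<bar>r\<bar> \<le> 2 * \<delta>"
    unfolding r_def abs_mult using assms by (intro mult_mono) linarith+
  moreover have "\<bar>(s - s') / 2\<bar> < \<delta>"
    using assms(1) by simp
  ultimately have "\<bar>(s - s') / 2 + d + r\<bar> < 4 * \<delta>"
    by linarith
  moreover have "(s / 2 + (1 - \<bar>s\<bar> / 2) * t) - (s' / 2 + (1 - \<bar>s'\<bar> / 2) * t') = (s - s') / 2 + d + r"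
    by (simp add: d_def r_def field_simps)
  ultimately show ?thesis
    by simp
qed

text \<open>The construction of \<open>Y\<close> reaches every balanced vector up to a reordering
  \<open>p\<close>; the reordering is what keeps all \<open>u k\<close> in [-1, 1].\<close>

lemma balanced_set_parametrization:
  assumes x: "x \<in> balanced_set (2 * m)"
  obtains p u t where "p permutes {1..2 * m}" "u 1 = u (m + 1)"
    "\<And>k. k \<in> {1..m + 1} \<Longrightarrow> \<bar>u k\<bar> \<le> 1" "\<And>k. k \<in> {1..m} \<Longrightarrow> \<bar>t k\<bar> \<le> 1"
    "\<And>k. k \<in> {1..m} \<Longrightarrow> x (p (2 * k - 1)) = (u k - u (k + 1)) / 2 + (1 - \<bar>u k - u (k + 1)\<bar> / 2) * t k"
    "\<And>k. k \<in> {1..m} \<Longrightarrow> x (p (2 * k)) = (u k - u (k + 1)) / 2 - (1 - \<bar>u k - u (k + 1)\<bar> / 2) * t k"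
proof -
  have x_le: "\<bar>x k\<bar> \<le> 1" if "k \<in> {1..2 * m}" for k
    using x that by (force simp: balanced_set_def PiE_iff)
  have x_sum: "(\<Sum>k=1..2 * m. x k) = 0"
    using x by (simp add: balanced_set_def)
  obtain p where p: "p permutes {1..2 * m}" "\<And>j. j \<le> 2 * m \<Longrightarrow> \<bar>\<Sum>i=1..j. x (p i)\<bar> \<le> 1"
    using balanced_ordering[of "2 * m" x] x_le x_sum by blast
  \<comment> \<open>The differences of \<open>u\<close> are the sums of the reordered pairs, as
    \<open>balanced_pair_surj\<close> needs. \<open>u 1\<close> is an empty sum, and
    \<open>u (m + 1)\<close> agrees with it because the total is 0.\<close>
  define u where "u k = - (\<Sum>i=1..2 * (k - 1). x (p i))" for k
  have u_diff: "u k - u (k + 1) = x (p (2 * k - 1)) + x (p (2 * k))" if "k \<in> {1..m}" for k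
    using that by (cases k) (auto simp: u_def)
  have p_le: "\<bar>x (p i)\<bar> \<le> 1" if "i \<in> {1..2 * m}" for i
    using x_le that permutes_in_image[OF p(1), of i] by blast
  have "\<forall>k\<in>{1..m}. \<exists>t. \<bar>t\<bar> \<le> 1 \<and>
      x (p (2 * k - 1)) = (u k - u (k + 1)) / 2 + (1 - \<bar>u k - u (k + 1)\<bar> / 2) * t \<and>
      x (p (2 * k)) = (u k - u (k + 1)) / 2 - (1 - \<bar>u k - u (k + 1)\<bar> / 2) * t"
  proof
    fix k assume k: "k \<in> {1..m}"
    have "\<bar>x (p (2 * k - 1))\<bar> \<le> 1" "\<bar>x (p (2 * k))\<bar> \<le> 1"
      using k by (auto intro!: p_le)
    then obtain t where t: "\<bar>t\<bar> \<le> 1"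
      "(u k - u (k + 1)) / 2 + (1 - \<bar>u k - u (k + 1)\<bar> / 2) * t = x (p (2 * k - 1))"
      "(u k - u (k + 1)) / 2 - (1 - \<bar>u k - u (k + 1)\<bar> / 2) * t = x (p (2 * k))"
      unfolding u_diff[OF k] by (rule balanced_pair_surj)
    then show "\<exists>t. \<bar>t\<bar> \<le> 1 \<and>
      x (p (2 * k - 1)) = (u k - u (k + 1)) / 2 + (1 - \<bar>u k - u (k + 1)\<bar> / 2) * t \<and>
      x (p (2 * k)) = (u k - u (k + 1)) / 2 - (1 - \<bar>u k - u (k + 1)\<bar> / 2) * t"
      by (intro exI[of _ t] conjI t(1) t(2)[symmetric] t(3)[symmetric])
  qed
  then obtain t where t: "\<forall>k\<in>{1..m}. \<bar>t k\<bar> \<le> 1 \<and>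
      x (p (2 * k - 1)) = (u k - u (k + 1)) / 2 + (1 - \<bar>u k - u (k + 1)\<bar> / 2) * t k \<and>
      x (p (2 * k)) = (u k - u (k + 1)) / 2 - (1 - \<bar>u k - u (k + 1)\<bar> / 2) * t k"
    by (rule bchoice[THEN exE])
  have u_cyclic: "u 1 = u (m + 1)"
    using x_sum sum.permute[OF p(1), of x] by (simp add: u_def o_def)
  have u_le: "\<bar>u k\<bar> \<le> 1" if "k \<in> {1..m + 1}" for k
    using p(2)[of "2 * (k - 1)"] that by (auto simp: u_def)
  show thesis
    using t by (intro that[OF p(1) u_cyclic u_le]) blast+
qed

subsection \<open>Open sets and the support\<close>

text \<open>An open set is the union of the boxes inside it with sides from a countable basis, and
  for finite \<open>I\<close> there are countably many such boxes. This makes the measures of open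
  sets in \<open>measure_support\<close> meaningful.\<close>

lemma openin_product_imp_sets_PiM:
  fixes U :: "('i \<Rightarrow> 'b::second_countable_topology) set"
  assumes "finite I" "openin (product_topology (\<lambda>_. euclidean) I) U"
  shows "U \<in> sets (PiM I (\<lambda>_. borel))"
proof -
  obtain B :: "'b set set" where B: "countable B" "topological_basis B"
    using ex_countable_basis by blast
  define F where "F = {V \<in> I \<rightarrow>\<^sub>E B. Pi\<^sub>E I V \<subseteq> U}"
  have "\<exists>V\<in>F. x \<in> Pi\<^sub>E I V" if x: "x \<in> U" for x
  proof -
    obtain V where V: "\<And>i. i \<in> I \<Longrightarrow> open (V i)" "x \<in> Pi\<^sub>E I V" "Pi\<^sub>E I V \<subseteq> U"
      using bspec[OF assms(2)[unfolded openin_product_topology_alt] x] by (auto simp: that)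
    have "\<forall>i\<in>I. \<exists>b\<in>B. x i \<in> b \<and> b \<subseteq> V i"
      using V B(2) by (meson PiE_mem topological_basisE)
    then obtain b where b: "\<And>i. i \<in> I \<Longrightarrow> b i \<in> B \<and> x i \<in> b i \<and> b i \<subseteq> V i"
      by metis
    have "Pi\<^sub>E I (restrict b I) \<subseteq> Pi\<^sub>E I V"
      using b by (intro PiE_mono) auto
    then show ?thesis
      using b V(2,3) by (intro bexI[of _ "restrict b I"]) (auto simp: F_def PiE_iff)
  qed
  then have "U = (\<Union>V\<in>F. Pi\<^sub>E I V)"
    by (auto simp: F_def)
  moreover have "countable F"
    using countable_PiE[of I "\<lambda>_. B"] assms(1) B(1) by (auto simp: F_def)
  moreover have "Pi\<^sub>E I V \<in> sets (PiM I (\<lambda>_. borel))" if "V \<in> F" for V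
    using that assms(1) topological_basis_open[OF B(2)]
    by (intro sets_PiM_I_finite) (auto simp: F_def PiE_iff)
  ultimately show ?thesis
    by auto
qed

text \<open>The preimage of 0 under the continuous coordinate sum meets a product of closed
  intervals. Closedness is what confines the support: the complement is an open set that can be
  shown to be null.\<close>

lemma closedin_balanced_set: "closedin (powertop_real {1..n}) (balanced_set n)"
proof -
  have "closedin (powertop_real {1..n})
      {x \<in> topspace (powertop_real {1..n}). (\<Sum>k=1..n. x k) \<in> {0}}"
    by (intro closedin_continuous_map_preimage[where Y = euclidean] continuous_intros) auto
  moreover have "closedin (powertop_real {1..n}) ({1..n} \<rightarrow>\<^sub>E {-1..1::real})"
    by (simp add: closedin_product_topology)
  ultimately have "closedin (powertop_real {1..n})
      ({x \<in> topspace (powertop_real {1..n}). (\<Sum>k=1..n. x k) \<in> {0}} \<inter> ({1..n} \<rightarrow>\<^sub>E {-1..1}))"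
    by blast
  also have "{x \<in> topspace (powertop_real {1..n}). (\<Sum>k=1..n. x k) \<in> {0}} \<inter> ({1..n} \<rightarrow>\<^sub>E {-1..1})
      = balanced_set n"
    by (fastforce simp: balanced_set_def PiE_iff extensional_def)
  finally show ?thesis .
qed

lemma openin_powertop_real_contains_box:
  fixes x :: "'i \<Rightarrow> real"
  assumes "finite I" "openin (powertop_real I) U" "x \<in> U"
  obtains \<epsilon> where "\<epsilon> > 0" "\<And>y. y \<in> extensional I \<Longrightarrow> (\<And>i. i \<in> I \<Longrightarrow> \<bar>y i - x i\<bar> < \<epsilon>) \<Longrightarrow> y \<in> U"
proof -
  obtain V where V: "\<And>i. i \<in> I \<Longrightarrow> open (V i)" "x \<in> Pi\<^sub>E I V" "Pi\<^sub>E I V \<subseteq> U"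
    using bspec[OF assms(2)[unfolded openin_product_topology_alt] assms(3)] by (auto simp: that)
  have "\<forall>i\<in>I. \<exists>e>0. ball (x i) e \<subseteq> V i"
    using V by (meson PiE_mem open_contains_ball)
  then obtain e where e: "\<And>i. i \<in> I \<Longrightarrow> e i > 0 \<and> ball (x i) (e i) \<subseteq> V i"
    by metis
  show thesis
  proof
    \<comment> \<open>The inserted 1 keeps the minimum meaningful and positive when \<open>I\<close>
      is empty.\<close>
    show "Min (insert 1 (e ` I)) > 0"
      using assms(1) e by auto
    fix y assume y: "y \<in> extensional I" "\<And>i. i \<in> I \<Longrightarrow> \<bar>y i - x i\<bar> < Min (insert 1 (e ` I))"
    have "y i \<in> V i" if "i \<in> I" for i
    proof -
      have "\<bar>y i - x i\<bar> < e i"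
        using y(2)[OF that] assms(1) that by simp
      then have "y i \<in> ball (x i) (e i)"
        by (simp add: dist_real_def abs_minus_commute)
      with e that show ?thesis
        by blast
    qed
    then have "y \<in> Pi\<^sub>E I V"
      using y(1) by (simp add: PiE_iff)
    with V(3) show "y \<in> U"
      by blast
  qed
qed

section \<open>Marginals, sum and support of the shuffled vector\<close>

theorem theorem8:
  fixes M :: "'a measure"
    and m n :: nat
    and X T S Y W :: "nat \<Rightarrow> 'a \<Rightarrow> real"
    and \<sigma> :: "'a \<Rightarrow> nat \<Rightarrow> nat"
  assumes "prob_space M"
    and "m > 1" and "n = 2 * m"
    and "\<And>k. k \<in> {1..m} \<Longrightarrow> uniform_pm1 M (X k)"
    and "\<And>k. k \<in> {1..m} \<Longrightarrow> uniform_pm1 M (T k)"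
    and "prob_space.indep_vars M (\<lambda>_. borel) (case_sum X T) ({1..m} <+> {1..m})"
    and "X (m + 1) = X 1"
    and "\<And>k \<omega>. k \<in> {1..m} \<Longrightarrow> \<omega> \<in> space M \<Longrightarrow> S k \<omega> = X k \<omega> - X (k + 1) \<omega>"
    and "\<And>k \<omega>. k \<in> {1..m} \<Longrightarrow> \<omega> \<in> space M \<Longrightarrow>
           Y (2 * k - 1) \<omega> = S k \<omega> / 2 + (1 - \<bar>S k \<omega>\<bar> / 2) * T k \<omega>"
    and "\<And>k \<omega>. k \<in> {1..m} \<Longrightarrow> \<omega> \<in> space M \<Longrightarrow>
           Y (2 * k) \<omega> = S k \<omega> / 2 - (1 - \<bar>S k \<omega>\<bar> / 2) * T k \<omega>"
    and "uniform_random_permutation M n \<sigma>"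
    and "indep_perm_vector M n \<sigma> Y"
    and "\<And>k \<omega>. k \<in> {1..n} \<Longrightarrow> \<omega> \<in> space M \<Longrightarrow> W k \<omega> = Y (\<sigma> \<omega> k) \<omega>"
  shows "random_balanced_sample M n W \<and>
         measure_support (powertop_real {1..n}) (joint_distribution M n W) = balanced_set n"
proof -
  interpret prob_space M by fact
  note n = assms(3) and X = assms(4) and T = assms(5) and indep = assms(6) and X_cyclic = assms(7)
    and S = assms(8) and Y_odd = assms(9) and Y_even = assms(10)
    and \<sigma> = assms(11) and indep_\<sigma> = assms(12) and W = assms(13)
  let ?I = "{1..m} <+> {1..m}"
  define Z where "Z = case_sum X T"
  have Z: "uniform_pm1 M (Z i)" if "i \<in> ?I" for i
    using that X T by (auto simp: Z_def)

  have Y_uniform: "uniform_pm1 M (Y l)" if l: "l \<in> {1..n}" for l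
  proof -
    obtain k where k: "k \<in> {1..m}" "l = 2 * k - 1 \<or> l = 2 * k"
      by (rule odd_even_pair_cases[OF l[unfolded n]])
    \<comment> \<open>The cyclic successor of \<open>k\<close> taken inside \<open>{1..m}\<close>,
      where the independent family is indexed. From \<open>m > 1\<close> follows
      \<open>j \<noteq> k\<close>, so three distinct members of the family are involved.\<close>
    define j where "j = (if k = m then 1 else k + 1)"
    have j: "j \<in> {1..m}" "j \<noteq> k" "X (k + 1) = X j"
      using k(1) \<open>m > 1\<close> X_cyclic by (auto simp: j_def)
    \<comment> \<open>The value 1 of \<open>e\<close> yields \<open>Y (2 * k - 1)\<close>, the value
      -1 yields \<open>Y (2 * k)\<close>.\<close>
    have pair: "uniform_pm1 M (\<lambda>\<omega>. (Z (Inl k) \<omega> - Z (Inl j) \<omega>) / 2 +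
        (1 - \<bar>Z (Inl k) \<omega> - Z (Inl j) \<omega>\<bar> / 2) * (e * Z (Inr k) \<omega>))" if "\<bar>e\<bar> = 1" for e
    proof (rule uniform_pm1_balanced_pair[OF \<open>prob_space M\<close> _ _ _ _ _ that])
      show "indep_vars (\<lambda>_. borel) Z {Inl k, Inl j, Inr k}"
        by (rule indep_vars_subset[OF indep[folded Z_def]]) (use j k(1) in auto)
    qed (use j k(1) in \<open>auto intro!: Z\<close>)
    from k(2) show ?thesis
    proof
      assume l: "l = 2 * k - 1"
      have "Y l \<omega> = (Z (Inl k) \<omega> - Z (Inl j) \<omega>) / 2 +
          (1 - \<bar>Z (Inl k) \<omega> - Z (Inl j) \<omega>\<bar> / 2) * (1 * Z (Inr k) \<omega>)" if "\<omega> \<in> space M" for \<omega>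
        unfolding l Y_odd[OF k(1) that] S[OF k(1) that] j(3) Z_def by simp
      then show ?thesis
        by (rule uniform_pm1_cong[THEN iffD2, OF _ pair]) simp_all
    next
      assume l: "l = 2 * k"
      have "Y l \<omega> = (Z (Inl k) \<omega> - Z (Inl j) \<omega>) / 2 +
          (1 - \<bar>Z (Inl k) \<omega> - Z (Inl j) \<omega>\<bar> / 2) * (- 1 * Z (Inr k) \<omega>)" if "\<omega> \<in> space M" for \<omega>
        unfolding l Y_even[OF k(1) that] S[OF k(1) that] j(3) Z_def by simp
      then show ?thesis
        by (rule uniform_pm1_cong[THEN iffD2, OF _ pair]) simp_all
    qed
  qed
  have W_uniform: "uniform_pm1 M (W k)" if "k \<in> {1..n}" for k
  proof (rule uniform_pm1_cong[THEN iffD2])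
    show "W k \<omega> = Y (\<sigma> \<omega> k) \<omega>" if "\<omega> \<in> space M" for \<omega>
      using W[OF \<open>k \<in> {1..n}\<close> that] .
    show "uniform_pm1 M (\<lambda>\<omega>. Y (\<sigma> \<omega> k) \<omega>)"
      using \<open>prob_space M\<close> \<sigma> indep_\<sigma> Y_uniform \<open>k \<in> {1..n}\<close> by (rule uniform_pm1_permuted)
  qed
  \<comment> \<open>The sum vanishes at every outcome: shuffling preserves it, the \<open>T\<close>
    terms cancel within each pair, and \<open>X (m + 1) = X 1\<close> closes the telescope.\<close>
  have W_sum: "(\<Sum>k=1..n. W k \<omega>) = 0" if \<omega>: "\<omega> \<in> space M" for \<omega>
  proof -
    have "(\<Sum>k=1..n. W k \<omega>) = (\<Sum>k=1..n. Y (\<sigma> \<omega> k) \<omega>)"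
      using W \<omega> by simp
    also have "\<dots> = (\<Sum>l=1..n. Y l \<omega>)"
      using sum.permute[OF uniform_random_permutation_permutes[OF \<sigma> \<omega>], of "\<lambda>l. Y l \<omega>"] by (simp add: o_def)
    also have "\<dots> = (\<Sum>k=1..m. Y (2 * k - 1) \<omega> + Y (2 * k) \<omega>)"
      unfolding n by (rule sum_consecutive_pairs)
    also have "\<dots> = (\<Sum>k=1..m. X k \<omega> - X (k + 1) \<omega>)"
      by (intro sum.cong refl) (simp only: Y_odd[OF _ \<omega>] Y_even[OF _ \<omega>] S[OF _ \<omega>], simp)
    also have "\<dots> = 0"
      using sum_telescope_from_1[of "\<lambda>k. X k \<omega>" m] X_cyclic by simp
    finally show ?thesis .
  qed
  have rbs: "random_balanced_sample M n W"
    unfolding random_balanced_sample_def using \<open>prob_space M\<close> W_uniform W_sum by auto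

  have Y_meas: "random_vector n Y \<in> M \<rightarrow>\<^sub>M PiM {1..n} (\<lambda>_. borel)"
    using Y_uniform by (intro random_vector_measurable) (simp add: uniform_pm1_iff_distr)
  have W_meas: "random_vector n W \<in> M \<rightarrow>\<^sub>M PiM {1..n} (\<lambda>_. borel)"
    using W_uniform by (intro random_vector_measurable) (simp add: uniform_pm1_iff_distr)
  have joint: "emeasure (joint_distribution M n W) U = emeasure M (random_vector n W -` U \<inter> space M)"
    if "openin (powertop_real {1..n}) U" for U
    unfolding joint_distribution_def using that
    by (intro emeasure_distr W_meas openin_product_imp_sets_PiM) auto

  have "measure_support (powertop_real {1..n}) (joint_distribution M n W) \<subseteq> balanced_set n"
  proof
    fix x assume x: "x \<in> measure_support (powertop_real {1..n}) (joint_distribution M n W)"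
    \<comment> \<open>This open complement has measure 0, so no point of the support lies in it.
      Only the bounds on the coordinates make the argument an almost sure one.\<close>
    define U where "U = topspace (powertop_real {1..n}) - balanced_set n"
    have U: "openin (powertop_real {1..n}) U"
      unfolding U_def by (intro openin_diff openin_topspace closedin_balanced_set)
    have "AE \<omega> in M. \<forall>k\<in>{1..n}. W k \<omega> \<in> {-1..1}"
      by (intro AE_finite_allI AE_uniform_pm1 W_uniform) auto
    then have "AE \<omega> in M. \<omega> \<notin> random_vector n W -` U \<inter> space M"
      using AE_space
    proof eventually_elim
      case (elim \<omega>)
      then have "random_vector n W \<omega> \<in> balanced_set n"
        using W_sum[of \<omega>] by (auto simp: balanced_set_def random_vector_def)
      then show ?case
        by (simp add: U_def)
    qed
    moreover have "random_vector n W -` U \<inter> space M \<in> sets M"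
      using U by (intro measurable_sets[OF W_meas] openin_product_imp_sets_PiM) auto
    ultimately have "emeasure (joint_distribution M n W) U = 0"
      unfolding joint[OF U] by (metis AE_iff_null_sets null_setsD1)
    with x U show "x \<in> balanced_set n"
      by (auto simp: measure_support_def U_def)
  qed
  moreover have "x \<in> measure_support (powertop_real {1..n}) (joint_distribution M n W)"
    if x: "x \<in> balanced_set n" for x
  proof -
    have "emeasure (joint_distribution M n W) U > 0"
      if U: "openin (powertop_real {1..n}) U" "x \<in> U" for U
    proof -
      obtain \<epsilon> where \<epsilon>: "\<epsilon> > 0" and
        box: "\<And>y. y \<in> extensional {1..n} \<Longrightarrow> (\<And>k. k \<in> {1..n} \<Longrightarrow> \<bar>y k - x k\<bar> < \<epsilon>) \<Longrightarrow> y \<in> U"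
        using openin_powertop_real_contains_box[OF _ U] by blast
      obtain p u t where p: "p permutes {1..n}" and u_cyclic: "u 1 = u (m + 1)"
        and u: "\<And>k. k \<in> {1..m + 1} \<Longrightarrow> \<bar>u k\<bar> \<le> 1" and t: "\<And>k. k \<in> {1..m} \<Longrightarrow> \<bar>t k\<bar> \<le> 1"
        and x_odd: "\<And>k. k \<in> {1..m} \<Longrightarrow>
          x (p (2 * k - 1)) = (u k - u (k + 1)) / 2 + (1 - \<bar>u k - u (k + 1)\<bar> / 2) * t k"
        and x_even: "\<And>k. k \<in> {1..m} \<Longrightarrow>
          x (p (2 * k)) = (u k - u (k + 1)) / 2 - (1 - \<bar>u k - u (k + 1)\<bar> / 2) * t k"
        using balanced_set_parametrization[OF x[unfolded n]] unfolding n by blast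
      \<comment> \<open>The 4 is the constant of \<open>balanced_pair_close\<close>, which also
        demands \<open>\<delta> \<le> 1\<close>.\<close>
      define \<delta> where "\<delta> = min 1 (\<epsilon> / 4)"
      have \<delta>: "\<delta> > 0" "\<delta> \<le> 1" "4 * \<delta> \<le> \<epsilon>"
        using \<epsilon> by (auto simp: \<delta>_def min_def)
      define z where "z = case_sum u t"
      define E where "E = (\<Inter>i\<in>?I. Z i -` {z i - \<delta><..<z i + \<delta>} \<inter> space M)"
      have "prob E > 0"
        unfolding E_def
      proof (rule indep_uniform_pm1_near[OF \<open>prob_space M\<close> _ _ _ Z _ \<delta>(1)])
        show "indep_vars (\<lambda>_. borel) Z ?I"
          using indep by (simp add: Z_def)
        show "?I \<noteq> {}"
          using \<open>m > 1\<close> by auto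
      qed (use u t in \<open>auto simp: z_def\<close>)

      \<comment> \<open>The box is centred at the reordered vector with coordinates
        \<open>x (p l)\<close>: parameters close to \<open>u\<close> and \<open>t\<close> bring
        \<open>Y\<close> close to it, before any shuffling.\<close>
      define B where "B = (\<Pi>\<^sub>E l\<in>{1..n}. {x (p l) - \<epsilon><..<x (p l) + \<epsilon>})"
      have B: "B \<in> sets (PiM {1..n} (\<lambda>_. borel))"
        unfolding B_def by (intro sets_PiM_I_finite) auto
      have "E \<subseteq> random_vector n Y -` B \<inter> space M"
      proof
        fix \<omega> assume "\<omega> \<in> E"
        then have near: "\<bar>Z i \<omega> - z i\<bar> < \<delta>" "\<omega> \<in> space M" if "i \<in> ?I" for i
          using INT_D[OF \<open>\<omega> \<in> E\<close>[unfolded E_def] that] by (simp_all add: abs_less_iff)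
        have \<omega>: "\<omega> \<in> space M"
          using near(2)[OF InlI, of 1] \<open>m > 1\<close> by auto
        \<comment> \<open>At \<open>k = m + 1\<close> both \<open>X\<close> and \<open>u\<close>
          return to their value at index 1, so closeness there is inherited.\<close>
        have near_X: "\<bar>X k \<omega> - u k\<bar> < \<delta>" if "k \<in> {1..m + 1}" for k
          using near(1)[OF InlI, of k] near(1)[OF InlI, of 1] that u_cyclic X_cyclic \<open>m > 1\<close>
          by (cases "k = m + 1") (auto simp: Z_def z_def)
        have near_T: "\<bar>T k \<omega> - t k\<bar> < \<delta>" if "k \<in> {1..m}" for k
          using near(1)[OF InrI, of k] that by (auto simp: Z_def z_def)
        have "\<bar>Y l \<omega> - x (p l)\<bar> < \<epsilon>" if l: "l \<in> {1..n}" for l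
        proof -
          obtain k where k: "k \<in> {1..m}" "l = 2 * k - 1 \<or> l = 2 * k"
            by (rule odd_even_pair_cases[OF l[unfolded n]])
          define s where "s = u k - u (k + 1)"
          have s: "\<bar>S k \<omega> - s\<bar> < 2 * \<delta>" "\<bar>s\<bar> \<le> 2"
            using near_X[of k] near_X[of "k + 1"] u[of k] u[of "k + 1"] S[OF k(1) \<omega>] k(1)
            by (auto simp: s_def)
          from k(2) show ?thesis
          proof
            assume l_eq: "l = 2 * k - 1"
            show ?thesis
              unfolding l_eq Y_odd[OF k(1) \<omega>] x_odd[OF k(1), folded s_def]
              by (rule less_le_trans[OF balanced_pair_close[OF s(1) near_T[OF k(1)] s(2) t[OF k(1)] \<delta>(2)] \<delta>(3)])
          next
            assume l_eq: "l = 2 * k"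
            \<comment> \<open>The even member is the odd one with \<open>T k\<close> and
              \<open>t k\<close> negated, so the same estimate applies.\<close>
            have "\<bar>- T k \<omega> - - t k\<bar> < \<delta>" "\<bar>- t k\<bar> \<le> 1"
              using near_T[OF k(1)] t[OF k(1)] by (simp_all add: abs_minus_commute)
            from less_le_trans[OF balanced_pair_close[OF s(1) this(1) s(2) this(2) \<delta>(2)] \<delta>(3)]
            show ?thesis
              unfolding l_eq Y_even[OF k(1) \<omega>] x_even[OF k(1), folded s_def] by simp
          qed
        qed
        then show "\<omega> \<in> random_vector n Y -` B \<inter> space M"
          using \<omega> by (auto simp: B_def random_vector_def abs_less_iff algebra_simps)
      qed
      then have "prob E \<le> prob (random_vector n Y -` B \<inter> space M)"
        by (intro finite_measure_mono measurable_sets[OF Y_meas] B)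
      with \<open>prob E > 0\<close> have pos: "prob (random_vector n Y -` B \<inter> space M) > 0"
        by simp

      \<comment> \<open>If \<open>\<sigma>\<close> takes the value \<open>inv p\<close>, then
        \<open>W k = Y (inv p k)\<close> is close to \<open>x (p (inv p k)) = x k\<close>: the
        shuffle undoes the reordering.\<close>
      let ?q = "inv p"
      have q: "?q permutes {1..n}"
        using p by (rule permutes_inv)
      have "{\<omega> \<in> space M. \<sigma> \<omega> = ?q} \<inter> (random_vector n Y -` B \<inter> space M)
          \<subseteq> random_vector n W -` U \<inter> space M"
      proof
        fix \<omega> assume "\<omega> \<in> {\<omega> \<in> space M. \<sigma> \<omega> = ?q} \<inter> (random_vector n Y -` B \<inter> space M)"
        then have \<omega>: "\<omega> \<in> space M" "\<sigma> \<omega> = ?q" "random_vector n Y \<omega> \<in> B"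
          by auto
        have "random_vector n W \<omega> \<in> U"
        proof (rule box)
          fix k assume k: "k \<in> {1..n}"
          then have "?q k \<in> {1..n}"
            using permutes_in_image[OF q] by blast
          then have "Y (?q k) \<omega> \<in> {x (p (?q k)) - \<epsilon><..<x (p (?q k)) + \<epsilon>}"
            using \<omega>(3) by (auto simp: B_def random_vector_def PiE_iff)
          moreover have "p (?q k) = k"
            using permutes_inverses(1)[OF p] .
          ultimately show "\<bar>random_vector n W \<omega> k - x k\<bar> < \<epsilon>"
            using W[OF k \<omega>(1)] \<omega>(2) k by (auto simp: random_vector_def)
        qed (simp add: random_vector_def)
        with \<omega>(1) show "\<omega> \<in> random_vector n W -` U \<inter> space M"
          by simp
      qed
      then have "prob ({\<omega> \<in> space M. \<sigma> \<omega> = ?q} \<inter> (random_vector n Y -` B \<inter> space M))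
          \<le> prob (random_vector n W -` U \<inter> space M)"
        using U by (intro finite_measure_mono measurable_sets[OF W_meas] openin_product_imp_sets_PiM) auto
      moreover have "prob ({\<omega> \<in> space M. \<sigma> \<omega> = ?q} \<inter> (random_vector n Y -` B \<inter> space M)) > 0"
        using measure_permutation_vector[OF \<open>prob_space M\<close> \<sigma> indep_\<sigma> q B] pos by simp
      ultimately show ?thesis
        using joint[OF U(1)] by (simp add: emeasure_eq_measure)
    qed
    then show ?thesis
      using x by (auto simp: measure_support_def balanced_set_def PiE_iff)
  qed
  ultimately show ?thesis
    using rbs by blast
qed

end
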